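(* Let $R$ be a finite ring and $I$ a proper (two-sided) ideal in $R$. For any $x \in R$, we have $\mathrm{Prob}_x(R) \leq \mathrm{Prob}_{x+I}(R/I)$.
   Context: Rings are associative with unity $1$, not necessarily commutative. For a finite ring $R$ and $x \in R$, the multiplication probability is $\mathrm{Prob}_x(R)=\frac{|\{(a,b) \in R^2 : ab=x\}|}{|R|^2}$. *)

theory Defs
  imports Complex_Main "HOL-Algebra.QuotRing"
begin

definition mult_prob :: "('a, 'b) ring_scheme \<Rightarrow> 'a \<Rightarrow> real" where
  "mult_prob R x =
     real (card {(a, b). a \<in> carrier R \<and> b \<in> carrier R \<and> a \<otimes>\<^bsub>R\<^esub> b = x}) /
     (real (card (carrier R)))\<^sup>2"

end

theory Submission imports Defs begin

text \<open>
  Reduction modulo \<open>I\<close> sends every factorisation \<open>a \<otimes> b = x\<close> in \<open>R\<close> to a factorisation of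
  \<open>I +> x\<close> in \<open>R Quot I\<close>, and at most \<open>card I ^ 2\<close> pairs of \<open>R\<close> lie over a given pair of cosets.
  Hence the number of factorisations of \<open>x\<close> is at most \<open>card I ^ 2\<close> times that of \<open>I +> x\<close>.
  By Lagrange's theorem \<open>card (carrier R) = card I * card (carrier (R Quot I))\<close>, so the factor
  \<open>card I ^ 2\<close> cancels in the quotient defining the probability.
\<close>

lemma (in ideal) card_carrier_eq_card_ideal_times_card_Quot:
  assumes "finite (carrier R)"
  shows "card (carrier R) = card I * card (carrier (R Quot I))"
proof -
  have "card (a_rcosets I) * card I = order (add_monoid R)"
    unfolding A_RCOSETS_def
    by (rule group.lagrange_finite[OF a_group]) (use assms a_subgroup in auto)
  then show ?thesis
    by (simp add: FactRing_def order_def mult.commute)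
qed

lemma (in ideal) card_coset_Quot:
  assumes "A \<in> carrier (R Quot I)"
  shows "card A = card I"
proof -
  have "A \<in> rcosets\<^bsub>add_monoid R\<^esub> I"
    using assms by (simp add: FactRing_def A_RCOSETS_def)
  moreover have "I \<subseteq> carrier (add_monoid R)"
    using a_subset by simp
  ultimately show ?thesis
    using group.card_rcosets_equal[OF a_group] by metis
qed

lemma (in ideal) card_factorisations_le_Quot:
  assumes fin: "finite (carrier R)"
  shows "card {(a, b). a \<in> carrier R \<and> b \<in> carrier R \<and> a \<otimes> b = x} \<le>
    card {(A, B). A \<in> carrier (R Quot I) \<and> B \<in> carrier (R Quot I) \<and>
            A \<otimes>\<^bsub>R Quot I\<^esub> B = I +> x} * (card I)\<^sup>2"
    (is "card ?S \<le> card ?T * _")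
proof -
  have finQ: "finite (carrier (R Quot I))"
  proof -
    have "carrier (R Quot I) = (\<lambda>a. I +> a) ` carrier R"
      by (auto simp: FactRing_def A_RCOSETS_def')
    then show ?thesis using fin by simp
  qed
  have finT: "finite ?T"
    by (rule finite_subset[of _ "carrier (R Quot I) \<times> carrier (R Quot I)"]) (use finQ in auto)
  have cosets_subset: "A \<subseteq> carrier R" if "A \<in> carrier (R Quot I)" for A
    using that a_r_coset_subset_G[OF a_subset] by (auto simp: FactRing_def A_RCOSETS_def')
  have finU: "finite (\<Union>(A, B)\<in>?T. A \<times> B)"
    by (rule finite_subset[of _ "carrier R \<times> carrier R"]) (use fin cosets_subset in auto)
  have "?S \<subseteq> (\<Union>(A, B)\<in>?T. A \<times> B)"
  proof clarify
    fix a b assume a: "a \<in> carrier R" and b: "b \<in> carrier R"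
    have "(I +> a) \<otimes>\<^bsub>R Quot I\<^esub> (I +> b) = I +> a \<otimes> b"
      using rcoset_mult_add[OF a b] by (simp add: FactRing_def)
    moreover have "I +> a \<in> carrier (R Quot I)" "I +> b \<in> carrier (R Quot I)"
      using a b by (auto simp: FactRing_def A_RCOSETS_def')
    moreover have "a \<in> I +> a" "b \<in> I +> b"
      using a b by (auto intro: a_rcos_self)
    ultimately show "(a, b) \<in> (\<Union>(A, B)\<in>{(A, B). A \<in> carrier (R Quot I) \<and>
        B \<in> carrier (R Quot I) \<and> A \<otimes>\<^bsub>R Quot I\<^esub> B = I +> a \<otimes> b}. A \<times> B)"
      by blast
  qed
  then have "card ?S \<le> card (\<Union>(A, B)\<in>?T. A \<times> B)"
    by (rule card_mono[OF finU])
  also have "\<dots> \<le> (\<Sum>(A, B)\<in>?T. card (A \<times> B))"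
    using card_UN_le[OF finT, of "\<lambda>(A, B). A \<times> B"] by (simp add: case_prod_unfold)
  also have "\<dots> = (\<Sum>p\<in>?T. (card I)\<^sup>2)"
    by (rule sum.cong) (auto simp: card_cartesian_product card_coset_Quot power2_eq_square)
  finally show ?thesis by simp
qed

theorem lemma2p6:
  fixes R :: "('a, 'b) ring_scheme" and I :: "'a set" and x :: 'a
  assumes "ring R" and "finite (carrier R)"
    and "ideal I R" and "I \<noteq> carrier R"
    and "x \<in> carrier R"
  shows "mult_prob R x \<le> mult_prob (R Quot I) (I +>\<^bsub>R\<^esub> x)"
proof -
  interpret ideal I R by fact
  define m where "m = card {(a, b). a \<in> carrier R \<and> b \<in> carrier R \<and> a \<otimes>\<^bsub>R\<^esub> b = x}"
  define n where "n = card {(A, B). A \<in> carrier (R Quot I) \<and> B \<in> carrier (R Quot I) \<and>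
            A \<otimes>\<^bsub>R Quot I\<^esub> B = I +>\<^bsub>R\<^esub> x}"
  define q where "q = card (carrier (R Quot I))"
  have "finite I"
    using a_subset assms(2) by (rule finite_subset)
  moreover have "I \<noteq> {}"
    using subgroup.one_closed[OF a_subgroup] by blast
  ultimately have I: "real (card I) > 0"
    by (simp add: card_gt_0_iff)
  have "m \<le> n * (card I)\<^sup>2"
    unfolding m_def n_def by (rule card_factorisations_le_Quot[OF assms(2)])
  then have le: "real m \<le> real n * (real (card I))\<^sup>2"
    by (metis of_nat_le_iff of_nat_mult of_nat_power)
  have "mult_prob R x = real m / (real (card I) * real q)\<^sup>2"
    using card_carrier_eq_card_ideal_times_card_Quot[OF assms(2)]
    by (simp add: mult_prob_def m_def q_def)
  also have "\<dots> \<le> real n * (real (card I))\<^sup>2 / (real (card I) * real q)\<^sup>2"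
    by (rule divide_right_mono[OF le]) simp
  also have "\<dots> = real n / (real q)\<^sup>2"
    using I by (simp add: power_mult_distrib)
  also have "\<dots> = mult_prob (R Quot I) (I +>\<^bsub>R\<^esub> x)"
    by (simp add: mult_prob_def n_def q_def)
  finally show ?thesis .
qed

end
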